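(* Let $(\mathbb{Z},b,\mathcal{D})$ be a pre-number system with $|b|\ge 3$, and for $t\in\mathbb{Z}$ define $\mathcal{D}_t=\{d+t \mid d\in\mathcal{D}\}$. Then there are only finitely many $t\in\mathbb{Z}$ such that $(\mathbb{Z},b,\mathcal{D}_t)$ is a number system. Moreover, if $0\in\mathcal{D}$, then the same statement holds for $\tilde{\mathcal{D}}_t=\{d+t\mid d\in\mathcal{D},\,d\ne 0\}\cup\{0\}$: there are only finitely many $t\in\mathbb{Z}$ such that $(\mathbb{Z},b,\tilde{\mathcal{D}}_t)$ is a number system.
   Context: A pre-number system $(\mathbb{Z},b,\mathcal{D})$ consists of an integer $b$ with $|b|\ge 2$ and a finite set $\mathcal{D}\subset\mathbb{Z}$ covering all residue classes modulo $b$; $\mathcal{D}$ is assumed irredundant, i.e. $|\mathcal{D}|=|b|$, so it has exactly one element in each residue class. A pre-number system is a number system if every $a\in\mathbb{Z}$ can be written as $a=\sum_{i=0}^{\ell-1}d_ib^i$ with $\ell\ge 1$ and all $d_i\in\mathcal{D}$. In particular, a triple that is not a pre-number system is not a number system. *)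

theory Defs
  imports "HOL-Number_Theory.Cong"
begin

definition pre_number_system :: "int \<Rightarrow> int set \<Rightarrow> bool" where
  "pre_number_system b D \<longleftrightarrow>
     \<bar>b\<bar> \<ge> 2 \<and> finite D \<and> (\<forall>a. \<exists>d\<in>D. [a = d] (mod b)) \<and> int (card D) = \<bar>b\<bar>"

definition number_system :: "int \<Rightarrow> int set \<Rightarrow> bool" where
  "number_system b D \<longleftrightarrow>
     pre_number_system b D \<and>
     (\<forall>a. \<exists>l\<ge>1. \<exists>d :: nat \<Rightarrow> int. (\<forall>i<l. d i \<in> D) \<and> a = (\<Sum>i<l. d i * b ^ i))"

definition translate_digits :: "int set \<Rightarrow> int \<Rightarrow> int set" where
  "translate_digits D t = {d + t | d. d \<in> D}"

definition translate_nonzero_digits :: "int set \<Rightarrow> int \<Rightarrow> int set" where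
  "translate_nonzero_digits D t = {d + t | d. d \<in> D \<and> d \<noteq> 0} \<union> {0}"

end

theory Submission
  imports Defs
begin

text \<open>
  If the nonzero digits all have absolute value close to \<open>\<bar>t\<bar>\<close> and \<open>\<bar>b\<bar> \<ge> 3\<close>, the leading nonzero
  term of \<open>\<Sum>i<l. d i * b ^ i\<close> dominates the remaining ones by a factor of about two. Hence every
  nonzero representable integer has absolute value at least about \<open>\<bar>t\<bar> / 2\<close>, so that \<open>1\<close> is not
  representable as soon as \<open>\<bar>t\<bar>\<close> is large. Both families of digit sets are of this kind.
\<close>

text \<open>Geometric series: \<open>B * (|b| ^ l - 1) / (|b| - 1)\<close> bounds the sum, and
  \<open>|b| - 1 \<ge> 2\<close>. Doubling the left side avoids division.\<close>

lemma abs_digit_sum_le: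
  fixes b B :: int and d :: "nat \<Rightarrow> int"
  assumes "\<bar>b\<bar> \<ge> 3" and "\<And>i. i < l \<Longrightarrow> \<bar>d i\<bar> \<le> B"
  shows "2 * \<bar>\<Sum>i<l. d i * b ^ i\<bar> \<le> B * (\<bar>b\<bar> ^ l - 1)"
  using assms(2)
proof (induction l)
  case 0
  then show ?case by simp
next
  case (Suc l)
  have IH: "2 * \<bar>\<Sum>i<l. d i * b ^ i\<bar> \<le> B * (\<bar>b\<bar> ^ l - 1)"
    using Suc by simp
  have d: "\<bar>d l\<bar> \<le> B"
    using Suc.prems by simp
  have top: "\<bar>d l * b ^ l\<bar> \<le> B * \<bar>b\<bar> ^ l"
    using d by (simp add: abs_mult power_abs mult_right_mono)
  \<comment> \<open>The old bound plus twice the new term is \<open>B * (3 * |b| ^ l - 1)\<close>,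
    so 3 must be absorbed into \<open>|b|\<close>.\<close>
  have "3 * (B * \<bar>b\<bar> ^ l) \<le> \<bar>b\<bar> * (B * \<bar>b\<bar> ^ l)"
    using assms(1) d by (intro mult_right_mono) auto
  moreover have "\<bar>\<Sum>i<Suc l. d i * b ^ i\<bar> \<le> \<bar>\<Sum>i<l. d i * b ^ i\<bar> + \<bar>d l * b ^ l\<bar>"
    by (simp add: abs_triangle_ineq)
  ultimately show ?case
    using IH top by (simp add: right_diff_distrib mult.left_commute)
qed

text \<open>If the highest nonzero digit is at position \<open>k\<close>, twice the absolute value
  is at least \<open>2 * A * |b| ^ k - B * (|b| ^ k - 1)\<close>, which is
  \<open>(2 * A - B) * |b| ^ k + B\<close>. The induction strips leading zeros until
  \<open>k\<close> is on top.\<close>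

lemma abs_digit_sum_ge:
  fixes b A B :: int and d :: "nat \<Rightarrow> int"
  assumes b: "\<bar>b\<bar> \<ge> 3" and AB: "B \<le> 2 * A" and "0 \<le> B"
    and "\<And>i. i < l \<Longrightarrow> d i = 0 \<or> A \<le> \<bar>d i\<bar> \<and> \<bar>d i\<bar> \<le> B"
    and "(\<Sum>i<l. d i * b ^ i) \<noteq> 0"
  shows "2 * A - B \<le> 2 * \<bar>\<Sum>i<l. d i * b ^ i\<bar>"
  using assms(4,5)
proof (induction l)
  case 0
  then show ?case by simp
next
  case (Suc l)
  show ?case
  proof (cases "d l = 0")
    case True
    with Suc show ?thesis by simp
  next
    case False
    have low: "2 * \<bar>\<Sum>i<l. d i * b ^ i\<bar> \<le> B * (\<bar>b\<bar> ^ l - 1)"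
      using Suc.prems(1) \<open>0 \<le> B\<close> by (intro abs_digit_sum_le b) (metis abs_zero less_Suc_eq)
    have "A \<le> \<bar>d l\<bar>"
      using Suc.prems(1)[of l] False by simp
    then have top: "A * \<bar>b\<bar> ^ l \<le> \<bar>d l * b ^ l\<bar>"
      by (simp add: abs_mult power_abs mult_right_mono)
    have "1 \<le> \<bar>b\<bar> ^ l"
      using b by (intro one_le_power) simp
    then have "(2 * A - B) * 1 \<le> (2 * A - B) * \<bar>b\<bar> ^ l"
      using AB by (intro mult_left_mono) auto
    moreover have "\<bar>d l * b ^ l\<bar> \<le> \<bar>\<Sum>i<Suc l. d i * b ^ i\<bar> + \<bar>\<Sum>i<l. d i * b ^ i\<bar>"
      by simp
    ultimately show ?thesis
      using low top \<open>0 \<le> B\<close> by (simp add: left_diff_distrib right_diff_distrib)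
  qed
qed

lemma not_number_system_if_nonzero_digits_large:
  fixes b A B :: int
  assumes "\<bar>b\<bar> \<ge> 3" and "B + 2 < 2 * A" and "0 \<le> B"
    and E: "\<And>e. e \<in> E \<Longrightarrow> e = 0 \<or> A \<le> \<bar>e\<bar> \<and> \<bar>e\<bar> \<le> B"
  shows "\<not> number_system b E"
proof
  assume "number_system b E"
  then obtain l and d :: "nat \<Rightarrow> int"
    where "\<forall>i<l. d i \<in> E" and one: "1 = (\<Sum>i<l. d i * b ^ i)"
    unfolding number_system_def by metis
  then have "2 * A - B \<le> 2 * \<bar>\<Sum>i<l. d i * b ^ i\<bar>"
    using assms(1-3) by (intro abs_digit_sum_ge E) auto
  with one \<open>B + 2 < 2 * A\<close> show False by simp
qed

text \<open>Covers both families at once; the alternative \<open>e = 0\<close> admits a digit 0 that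
  is not translated.\<close>

lemma finite_number_system_near_translates:
  fixes b M :: int and E :: "int \<Rightarrow> int set"
  assumes "\<bar>b\<bar> \<ge> 3"
    and near: "\<And>t e. e \<in> E t \<Longrightarrow> e = 0 \<or> \<bar>e - t\<bar> \<le> M"
  shows "finite {t. number_system b (E t)}"
proof (rule finite_subset)
  \<comment> \<open>\<open>N \<ge> 0\<close> keeps the interval below nonempty. With
    \<open>A = |t| - N\<close> and \<open>B = |t| + N\<close>, the condition
    \<open>B + 2 < 2 * A\<close> says exactly \<open>|t| > 3 * N + 2\<close>.\<close>
  define N where "N = max M 0"
  show "{t. number_system b (E t)} \<subseteq> {- (3 * N + 2)..3 * N + 2}"
  proof (rule subsetI, rule ccontr)
    fix t
    assume t: "t \<in> {t. number_system b (E t)}" "t \<notin> {- (3 * N + 2)..3 * N + 2}"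
    have "\<not> number_system b (E t)"
    proof (rule not_number_system_if_nonzero_digits_large)
      show "(\<bar>t\<bar> + N) + 2 < 2 * (\<bar>t\<bar> - N)" "0 \<le> \<bar>t\<bar> + N"
        using t(2) by (auto simp: N_def)
      show "e = 0 \<or> \<bar>t\<bar> - N \<le> \<bar>e\<bar> \<and> \<bar>e\<bar> \<le> \<bar>t\<bar> + N" if "e \<in> E t" for e
        using near[OF that] by (auto simp: N_def)
    qed fact
    with t(1) show False by simp
  qed
qed simp

theorem theorem2p18:
  fixes b :: int and D :: "int set"
  assumes "pre_number_system b D" and "\<bar>b\<bar> \<ge> 3"
  shows "finite {t. number_system b (translate_digits D t)} \<and>
         (0 \<in> D \<longrightarrow> finite {t. number_system b (translate_nonzero_digits D t)})"
proof -
  have "finite D"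
    using assms(1) by (simp add: pre_number_system_def)
  then have M: "\<bar>d\<bar> \<le> Max (abs ` D)" if "d \<in> D" for d
    using that by simp
  have "finite {t. number_system b (translate_digits D t)}"
    \<comment> \<open>The digit \<open>d + t\<close> is at distance \<open>|d|\<close> from
      \<open>t\<close>.\<close>
    by (rule finite_number_system_near_translates[OF assms(2), where M = "Max (abs ` D)"])
      (auto simp: translate_digits_def dest: M)
  moreover have "finite {t. number_system b (translate_nonzero_digits D t)}"
    by (rule finite_number_system_near_translates[OF assms(2), where M = "Max (abs ` D)"])
      (auto simp: translate_nonzero_digits_def dest: M)
  ultimately show ?thesis by blast
qed

end
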